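(* Let $\mathbb{H}$ be an infinite-dimensional real Hilbert space and let $T,A:\mathbb{H}\to\mathbb{H}$ be compact linear operators. Then $T\perp_B A$ if and only if there exists $x\in M_T$ such that $Tx\perp Ax$, i.e. $\langle Tx,Ax\rangle=0$.
   Context: All spaces are real. $M_T=\{x\in\mathbb{H}:\|x\|=1,\ \|Tx\|=\|T\|\}$ is the norm attainment set of $T$, where $\|T\|$ is the operator norm. Birkhoff-James orthogonality of operators: $T\perp_B A$ means $\|T+\lambda A\|\ge\|T\|$ for all $\lambda\in\mathbb{R}$. *)

theory Defs
  imports "HOL-Analysis.Analysis"
begin

text \<open>Boundedness of a compact operator is not assumed: it follows from linearity and
  relative compactness of the image of the unit ball, so that \<^const>\<open>onorm\<close> is the
  genuine operator norm for the operators considered here.\<close>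

definition compact_operator ::
    "('a::real_normed_vector \<Rightarrow> 'b::real_normed_vector) \<Rightarrow> bool" where
  "compact_operator T \<longleftrightarrow> linear T \<and> (\<forall>S. bounded S \<longrightarrow> compact (closure (T ` S)))"

definition norm_attainment_set ::
    "('a::real_normed_vector \<Rightarrow> 'b::real_normed_vector) \<Rightarrow> 'a set" where
  "norm_attainment_set T = {x. norm x = 1 \<and> norm (T x) = onorm T}"

definition BJ_orthogonal ::
    "('a::real_normed_vector \<Rightarrow> 'b::real_normed_vector) \<Rightarrow> ('a \<Rightarrow> 'b) \<Rightarrow> bool" where
  "BJ_orthogonal T A \<longleftrightarrow> (\<forall>c::real. onorm (\<lambda>x. T x + c *\<^sub>R A x) \<ge> onorm T)"

definition infinite_dimensional :: "'a::real_vector set \<Rightarrow> bool" where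
  "infinite_dimensional V \<longleftrightarrow> \<not> (\<exists>B. finite B \<and> B \<subseteq> V \<and> V \<subseteq> span B)"

end

theory Submission
  imports Defs
begin

text \<open>Perturbing \<open>T\<close> by small positive multiples of \<open>A\<close> produces unit vectors that almost attain the
  norm of \<open>T\<close> and on which \<open>\<langle>Tx, Ax\<rangle>\<close> is almost nonnegative. By compactness of \<open>T\<close> and the
  parallelogram law such vectors have a convergent subsequence, whose limit is a norm attaining
  vector with \<open>\<langle>Tx, Ax\<rangle> \<ge> 0\<close>. The same argument for \<open>-A\<close> gives the opposite sign. The norm attaining
  vectors span a subspace on which \<open>T\<close> is a multiple of an isometry, so the two vectors can be joined
  by a segment inside it, and the intermediate value theorem yields a zero.\<close>

lemma compact_operator_imp_bounded_linear:
  assumes "compact_operator T"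
  shows "bounded_linear T"
proof -
  have lin: "linear T" and "compact (closure (T ` cball 0 1))"
    using assms bounded_cball by (auto simp: compact_operator_def)
  then have "bounded (T ` cball 0 1)"
    by (intro bounded_subset[OF compact_imp_bounded closure_subset])
  then obtain K where K: "\<And>x. norm x \<le> 1 \<Longrightarrow> norm (T x) \<le> K"
    by (force simp: bounded_iff)
  have "norm (T x) \<le> norm x * K" for x
  proof (cases "x = 0")
    case True
    then show ?thesis using lin by (simp add: linear_0)
  next
    case False
    have "norm (T (x /\<^sub>R norm x)) \<le> K"
      using False by (intro K) simp
    then have "norm (T x) / norm x \<le> K"
      using lin by (simp add: linear_scale divide_inverse_commute)
    then show ?thesis
      using False by (simp add: divide_le_eq mult.commute)
  qed
  then show ?thesis
    using lin by (auto simp: bounded_linear_def bounded_linear_axioms_def)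
qed

text \<open>If \<open>norm (f x) \<le> b * norm x\<close> held for all \<open>x\<close>, then
  \<open>b\<close> would bound the operator norm; so some vector violates this, and it can be
  normalised. The strict inequality spares any assumption that the norm is attained.\<close>

lemma less_onorm_imp_unit_vector:
  assumes "bounded_linear f" "0 \<le> b" "b < onorm f"
  obtains x where "norm x = 1" "b < norm (f x)"
proof -
  have "\<exists>x. norm (f x) > b * norm x"
    using onorm_bound[OF assms(2), of f] assms(3) by (meson not_le)
  then obtain x where x: "norm (f x) > b * norm x" by blast
  have "f 0 = 0" using assms(1) by (simp add: linear_0 bounded_linear.linear)
  with x have "x \<noteq> 0" by auto
  then have "norm (x /\<^sub>R norm x) = 1" by simp
  moreover have "b < norm (f (x /\<^sub>R norm x))"
    using x \<open>x \<noteq> 0\<close> assms(1) by (simp add: linear_scale bounded_linear.linear field_simps)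
  ultimately show ?thesis using that by blast
qed

lemma parallelogram_law:
  fixes x y :: "'a::real_inner"
  shows "(norm (x + y))\<^sup>2 + (norm (x - y))\<^sup>2 = 2 * (norm x)\<^sup>2 + 2 * (norm y)\<^sup>2"
  by (simp add: power2_norm_eq_inner inner_simps inner_commute)

text \<open>Compactness makes the images converge along a subsequence to some \<open>y\<close> of
  norm \<open>onorm T\<close>. Then \<open>T (u m + u n)\<close> is close to \<open>2 y\<close>, so
  \<open>u m + u n\<close> has norm close to 2. For unit vectors the parallelogram law turns this
  into smallness of \<open>u m - u n\<close>, and completeness gives the limit.\<close>

lemma maximizing_sequence_convergent_subsequence:
  fixes T :: "'a::{real_inner, complete_space} \<Rightarrow> 'b::real_normed_vector"
  assumes T: "compact_operator T" and pos: "onorm T > 0"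
    and unit: "\<And>n. norm (x n) = 1" and lim: "(\<lambda>n. norm (T (x n))) \<longlonglongrightarrow> onorm T"
  obtains l r where "strict_mono (r :: nat \<Rightarrow> nat)" "(x \<circ> r) \<longlonglongrightarrow> l"
proof -
  let ?K = "onorm T"
  have bl: "bounded_linear T" using T by (rule compact_operator_imp_bounded_linear)
  have "compact (closure (T ` cball 0 1))"
    using T bounded_cball by (auto simp: compact_operator_def)
  moreover have "\<forall>n. T (x n) \<in> closure (T ` cball 0 1)"
    using unit by (intro allI subsetD[OF closure_subset]) auto
  ultimately obtain y r where r: "strict_mono r" and y: "((\<lambda>n. T (x n)) \<circ> r) \<longlonglongrightarrow> y"
    unfolding compact_def by metis
  define u where "u = x \<circ> r"
  have Tu: "(\<lambda>n. T (u n)) \<longlonglongrightarrow> y" using y by (simp add: u_def o_def)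
  have "(\<lambda>n. norm (T (u n))) \<longlonglongrightarrow> ?K"
    using LIMSEQ_subseq_LIMSEQ[OF lim r] by (simp add: u_def o_def)
  then have ny: "norm y = ?K"
    using tendsto_norm[OF Tu] LIMSEQ_unique by blast
  have nu: "norm (u n) = 1" for n using unit by (simp add: u_def)
  have "Cauchy u"
  proof (rule metric_CauchyI)
    fix e :: real assume e: "e > 0"
    \<comment> \<open>The final estimate is \<open>8 * d\<close>, which is half of the square of
      \<open>e\<close>.\<close>
    define d where "d = e\<^sup>2 / 16"
    have d: "d > 0" using e by (simp add: d_def)
    obtain N where N: "\<And>n. n \<ge> N \<Longrightarrow> norm (T (u n) - y) < ?K * d"
      using LIMSEQ_D[OF Tu, of "?K * d"] pos d by auto
    have "dist (u m) (u n) < e" if "m \<ge> N" "n \<ge> N" for m n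
    proof -
      let ?s = "norm (u m + u n)"
      have "2 * ?K = norm ((2::real) *\<^sub>R y)" using ny by simp
      also have "(2::real) *\<^sub>R y = T (u m + u n) - ((T (u m) - y) + (T (u n) - y))"
        using bl by (simp add: linear_add bounded_linear.linear scaleR_2)
      also have "norm \<dots> \<le> norm (T (u m + u n)) + (norm (T (u m) - y) + norm (T (u n) - y))"
        by (meson add_left_mono norm_triangle_ineq norm_triangle_ineq4 order_trans)
      also have "\<dots> \<le> ?K * ?s + (?K * d + ?K * d)"
        using onorm[OF bl] N[OF that(1)] N[OF that(2)] by (intro add_mono) auto
      finally have "?K * 2 \<le> ?K * (?s + 2 * d)" by (simp add: algebra_simps)
      then have s: "?s \<ge> 2 - 2 * d" using pos by simp
      \<comment> \<open>The tangent line of the square at 2 transfers the lower bound from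
        \<open>?s\<close> to its square, whatever the sign of \<open>2 - 2 * d\<close>.\<close>
      have "0 \<le> (?s - 2)\<^sup>2" by simp
      then have "?s\<^sup>2 \<ge> 4 * ?s - 4" by (simp add: power2_eq_square algebra_simps)
      with s have "?s\<^sup>2 \<ge> 4 - 8 * d" by simp
      then have "(norm (u m - u n))\<^sup>2 \<le> 8 * d"
        using parallelogram_law[of "u m" "u n"] nu by simp
      also have "\<dots> < e\<^sup>2" using e by (simp add: d_def)
      finally show ?thesis using e by (simp add: dist_norm power_less_imp_less_base)
    qed
    then show "\<exists>M. \<forall>m\<ge>M. \<forall>n\<ge>M. dist (u m) (u n) < e" by blast
  qed
  then obtain l where "u \<longlonglongrightarrow> l" using Cauchy_convergent convergent_def by blast
  then show ?thesis using r that by (simp add: u_def)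
qed

text \<open>Unit vectors at which \<open>T + c A\<close> nearly reaches \<open>onorm T\<close> form
  a maximizing sequence for \<open>T\<close> as \<open>c\<close> tends to 0 from above. The
  first-order term in \<open>c\<close> of the squared norm controls the sign of the inner product,
  which survives in the limit.\<close>

lemma onorm_add_mult_ge_imp_nonneg_inner:
  fixes T A :: "'a::{real_inner, complete_space} \<Rightarrow> 'b::real_inner"
  assumes T: "compact_operator T" and A: "bounded_linear A" and pos: "onorm T > 0"
    and ge: "\<And>c::real. c > 0 \<Longrightarrow> onorm (\<lambda>x. T x + c *\<^sub>R A x) \<ge> onorm T"
  obtains x where "x \<in> norm_attainment_set T" "T x \<bullet> A x \<ge> 0"
proof -
  let ?K = "onorm T" and ?L = "onorm A"
  have bl: "bounded_linear T" using T by (rule compact_operator_imp_bounded_linear)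
  define c :: "nat \<Rightarrow> real" where "c n = 1 / Suc n" for n
  have c0: "c n > 0" "c n \<le> 1" for n by (auto simp: c_def)
  have c_lim: "c \<longlonglongrightarrow> 0" unfolding c_def by (rule LIMSEQ_Suc[OF lim_1_over_n])
  \<comment> \<open>The loss is of second order in \<open>c n\<close>, so that it still vanishes in
    the limit after a later division by \<open>c n\<close>. Since \<open>c n \<le> 1\<close>, the
    threshold is nonnegative and may be squared.\<close>
  have "\<exists>x. norm x = 1 \<and> ?K * (1 - (c n)\<^sup>2) < norm (T x + c n *\<^sub>R A x)" for n
  proof -
    have "bounded_linear (\<lambda>x. T x + c n *\<^sub>R A x)"
      using bl A by (intro bounded_linear_add bounded_linear_scaleR_right[THEN bounded_linear_compose])
    moreover have "0 \<le> ?K * (1 - (c n)\<^sup>2)"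
      using pos c0[of n] by (simp add: power_le_one)
    moreover have "?K * (1 - (c n)\<^sup>2) < onorm (\<lambda>x. T x + c n *\<^sub>R A x)"
    proof -
      have "?K * (1 - (c n)\<^sup>2) < ?K" using pos c0(1)[of n] by simp
      then show ?thesis using ge[OF c0(1)] by (rule less_le_trans)
    qed
    ultimately show ?thesis by (rule less_onorm_imp_unit_vector) blast
  qed
  then obtain x where x: "\<And>n. norm (x n) = 1"
    and xc: "\<And>n. ?K * (1 - (c n)\<^sup>2) < norm (T (x n) + c n *\<^sub>R A (x n))" by metis
  have TK: "norm (T (x n)) \<le> ?K" and AL: "norm (A (x n)) \<le> ?L" for n
    using onorm[OF bl, of "x n"] onorm[OF A, of "x n"] x by auto
  have lower: "?K * (1 - (c n)\<^sup>2) - c n * ?L \<le> norm (T (x n))" for n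
  proof -
    have "norm (T (x n) + c n *\<^sub>R A (x n)) \<le> norm (T (x n)) + c n * norm (A (x n))"
      using norm_triangle_ineq[of "T (x n)" "c n *\<^sub>R A (x n)"] c0(1)[of n] by simp
    also have "\<dots> \<le> norm (T (x n)) + c n * ?L"
      using AL[of n] c0(1)[of n] by simp
    finally show ?thesis using xc[of n] by linarith
  qed
  \<comment> \<open>Expand the squared norm and bound its two pure squares by those of
    \<open>?K\<close> and \<open>?L\<close>. All terms other than the inner product are then of
    second order in \<open>c n\<close>, and one factor \<open>c n > 0\<close> cancels.\<close>
  have inner_lower: "- (c n * ((2 * ?K\<^sup>2 + ?L\<^sup>2) / 2)) \<le> T (x n) \<bullet> A (x n)" for n
  proof -
    let ?c = "c n" and ?p = "T (x n) \<bullet> A (x n)"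
    have "?K\<^sup>2 * (1 - 2 * ?c\<^sup>2) \<le> ?K\<^sup>2 * (1 - ?c\<^sup>2)\<^sup>2"
      using c0(1)[of n] by (intro mult_left_mono) (auto simp: power2_eq_square algebra_simps)
    also have "\<dots> = (?K * (1 - ?c\<^sup>2))\<^sup>2" by (simp add: power_mult_distrib)
    also have "\<dots> \<le> (norm (T (x n) + ?c *\<^sub>R A (x n)))\<^sup>2"
      using xc[of n] pos c0[of n] by (intro power_mono) (auto simp: power_le_one)
    also have "\<dots> = (norm (T (x n)))\<^sup>2 + 2 * ?c * ?p + ?c\<^sup>2 * (norm (A (x n)))\<^sup>2"
      unfolding power2_norm_eq_inner
      by (simp add: inner_simps inner_commute power2_eq_square algebra_simps)
    also have "\<dots> \<le> ?K\<^sup>2 + 2 * ?c * ?p + ?c\<^sup>2 * ?L\<^sup>2"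
      by (intro add_mono order_refl mult_left_mono power_mono TK AL) simp_all
    finally have "?c * 0 \<le> ?c * (2 * ?p + ?c * (2 * ?K\<^sup>2 + ?L\<^sup>2))"
      by (simp add: power2_eq_square algebra_simps)
    then have "0 \<le> 2 * ?p + ?c * (2 * ?K\<^sup>2 + ?L\<^sup>2)"
      using c0(1)[of n] by (simp only: mult_le_cancel_left_pos)
    then show ?thesis by (simp add: field_simps)
  qed
  have "(\<lambda>n. ?K * (1 - (c n)\<^sup>2) - c n * ?L) \<longlonglongrightarrow> ?K * (1 - 0\<^sup>2) - 0 * ?L"
    by (intro tendsto_intros c_lim)
  then have "(\<lambda>n. ?K * (1 - (c n)\<^sup>2) - c n * ?L) \<longlonglongrightarrow> ?K" by simp
  from tendsto_sandwich[OF _ _ this tendsto_const]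
  have norm_lim: "(\<lambda>n. norm (T (x n))) \<longlonglongrightarrow> ?K" using lower TK by simp
  obtain l r where r: "strict_mono r" and l: "(x \<circ> r) \<longlonglongrightarrow> l"
    by (rule maximizing_sequence_convergent_subsequence[OF T pos x norm_lim])
  have l: "(\<lambda>n. x (r n)) \<longlonglongrightarrow> l" using l by (simp add: o_def)
  note Tl = bounded_linear.tendsto[OF bl l] and Al = bounded_linear.tendsto[OF A l]
  have "norm l = 1"
    using tendsto_norm[OF l] x by (simp add: LIMSEQ_const_iff)
  moreover have "norm (T l) = ?K"
    using LIMSEQ_unique[OF tendsto_norm[OF Tl]] LIMSEQ_subseq_LIMSEQ[OF norm_lim r]
    by (simp add: o_def)
  moreover have "0 \<le> T l \<bullet> A l"
  proof -
    have "(\<lambda>n. c (r n)) \<longlonglongrightarrow> 0"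
      using LIMSEQ_subseq_LIMSEQ[OF c_lim r] by (simp add: o_def)
    then have "(\<lambda>n. - (c (r n) * ((2 * ?K\<^sup>2 + ?L\<^sup>2) / 2))) \<longlonglongrightarrow> - (0 * ((2 * ?K\<^sup>2 + ?L\<^sup>2) / 2))"
      by (intro tendsto_minus tendsto_mult tendsto_const)
    then have "- (0 * ((2 * ?K\<^sup>2 + ?L\<^sup>2) / 2)) \<le> T l \<bullet> A l"
      by (rule LIMSEQ_le[OF _ tendsto_inner[OF Tl Al]]) (use inner_lower in blast)
    then show ?thesis by simp
  qed
  ultimately show ?thesis using that by (simp add: norm_attainment_set_def)
qed

text \<open>By the parallelogram law in both spaces, the bounds
  \<open>norm (T v) \<le> onorm T * norm v\<close> for \<open>v = x + y\<close> and
  \<open>v = x - y\<close> have squares that add up to an equality, so each is an equality. The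
  homogeneous form of the hypotheses admits vectors of any length.\<close>

lemma norm_eq_onorm_add:
  fixes T :: "'a::real_inner \<Rightarrow> 'b::real_inner"
  assumes bl: "bounded_linear T"
    and x: "norm (T x) = onorm T * norm x" and y: "norm (T y) = onorm T * norm y"
  shows "norm (T (x + y)) = onorm T * norm (x + y)"
proof -
  let ?K = "onorm T"
  have K: "?K \<ge> 0" using bl by (rule onorm_pos_le)
  have le: "(norm (T v))\<^sup>2 \<le> (?K * norm v)\<^sup>2" for v
    using onorm[OF bl, of v] by (rule power_mono) simp
  have "(norm (T (x + y)))\<^sup>2 + (norm (T (x - y)))\<^sup>2 = 2 * (norm (T x))\<^sup>2 + 2 * (norm (T y))\<^sup>2"
    using bl by (simp add: linear_add linear_diff bounded_linear.linear parallelogram_law)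
  also have "\<dots> = ?K\<^sup>2 * (2 * (norm x)\<^sup>2 + 2 * (norm y)\<^sup>2)"
    by (simp add: x y power_mult_distrib algebra_simps)
  also have "\<dots> = (?K * norm (x + y))\<^sup>2 + (?K * norm (x - y))\<^sup>2"
    by (simp only: parallelogram_law[symmetric] power_mult_distrib distrib_left)
  finally have "(norm (T (x + y)))\<^sup>2 = (?K * norm (x + y))\<^sup>2"
    using le[of "x + y"] le[of "x - y"] by linarith
  then show ?thesis using K by (simp add: power2_eq_iff_nonneg)
qed

lemma norm_attaining_inner_zero:
  fixes T A :: "'a::real_inner \<Rightarrow> 'b::real_inner"
  assumes T: "bounded_linear T" and A: "bounded_linear A"
    and x: "x \<in> norm_attainment_set T" "T x \<bullet> A x \<ge> 0"
    and y: "y \<in> norm_attainment_set T" "T y \<bullet> A y \<le> 0"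
  obtains z where "z \<in> norm_attainment_set T" "T z \<bullet> A z = 0"
proof -
  let ?K = "onorm T"
  have nx: "norm x = 1" "norm (T x) = ?K" and ny: "norm y = 1" "norm (T y) = ?K"
    using x y by (auto simp: norm_attainment_set_def)
  have lin: "linear T" "linear A" using T A by (auto simp: bounded_linear.linear)
  define p where "p t = (1 - t) *\<^sub>R x + t *\<^sub>R y" for t :: real
  have "continuous_on {0..1} (\<lambda>t. T (p t) \<bullet> A (p t))"
    unfolding p_def
    by (intro continuous_intros bounded_linear.continuous_on[OF T] bounded_linear.continuous_on[OF A])
  then obtain t where t: "0 \<le> t" "t \<le> 1" "T (p t) \<bullet> A (p t) = 0"
    using IVT2'[of "\<lambda>t. T (p t) \<bullet> A (p t)" 1 0 0] x(2) y(2) by (auto simp: p_def)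
  show ?thesis
  proof (cases "p t = 0")
    case True
    \<comment> \<open>The segment between unit vectors meets the origin only if they are antipodal.\<close>
    then have eq: "(1 - t) *\<^sub>R x = - t *\<^sub>R y" by (simp add: p_def add_eq_0_iff2)
    then have "norm ((1 - t) *\<^sub>R x) = norm (t *\<^sub>R y)" by simp
    then have "t = 1 / 2" using t nx ny by simp
    with eq have "(1 / 2 :: real) *\<^sub>R x = (1 / 2 :: real) *\<^sub>R - y" by simp
    then have "x = - y" by (subst (asm) scaleR_cancel_left) simp
    then have "T x \<bullet> A x = T y \<bullet> A y" using lin by (simp add: linear_neg)
    then show ?thesis using x y that[of x] by simp
  next
    case False
    have "norm (T (p t)) = ?K * norm (p t)"
      unfolding p_def by (rule norm_eq_onorm_add[OF T]) (simp_all add: linear_scale[OF lin(1)] nx ny)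
    \<comment> \<open>Normalising preserves the homogeneous norm equality and multiplies the inner
      product by a scalar, so its zero persists.\<close>
    then have "p t /\<^sub>R norm (p t) \<in> norm_attainment_set T"
      using False lin by (simp add: norm_attainment_set_def linear_scale)
    moreover have "T (p t /\<^sub>R norm (p t)) \<bullet> A (p t /\<^sub>R norm (p t)) = 0"
      using t lin by (simp add: linear_scale)
    ultimately show ?thesis by (rule that)
  qed
qed

theorem corollary2p2p1:
  fixes T A :: "'a::{real_inner, complete_space} \<Rightarrow> 'a"
  assumes "infinite_dimensional (UNIV :: 'a set)"
    and "compact_operator T"
    and "compact_operator A"
  shows "BJ_orthogonal T A \<longleftrightarrow> (\<exists>x\<in>norm_attainment_set T. T x \<bullet> A x = 0)"
proof -
  have T: "bounded_linear T" and A: "bounded_linear A"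
    using assms compact_operator_imp_bounded_linear by auto
  show ?thesis
  proof
    assume BJ: "BJ_orthogonal T A"
    show "\<exists>x\<in>norm_attainment_set T. T x \<bullet> A x = 0"
    proof (cases "onorm T = 0")
      case True
      then have T0: "T v = 0" for v using onorm_eq_0[OF T] by simp
      \<comment> \<open>For \<open>T = 0\<close> every unit vector attains the norm and satisfies
        the equation; infinite dimension supplies one.\<close>
      have "\<exists>v::'a. v \<noteq> 0"
      proof (rule ccontr)
        assume "\<not> (\<exists>v::'a. v \<noteq> 0)"
        then have "(UNIV :: 'a set) \<subseteq> span {}" by auto
        then show False using assms(1) unfolding infinite_dimensional_def by blast
      qed
      then obtain v :: 'a where "v \<noteq> 0" by blast
      then have "v /\<^sub>R norm v \<in> norm_attainment_set T"
        using True T0 by (simp add: norm_attainment_set_def)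
      then show ?thesis using T0 by (intro bexI) auto
    next
      case False
      then have pos: "onorm T > 0" using onorm_pos_le[OF T] by simp
      have ge: "onorm (\<lambda>x. T x + c *\<^sub>R A x) \<ge> onorm T" for c
        using BJ by (simp add: BJ_orthogonal_def)
      obtain x where x: "x \<in> norm_attainment_set T" "T x \<bullet> A x \<ge> 0"
        by (rule onorm_add_mult_ge_imp_nonneg_inner[OF assms(2) A pos ge])
      \<comment> \<open>Orthogonality covers both signs of the scalar, so negative multiples of
        \<open>A\<close> become positive multiples of \<open>- A\<close>.\<close>
      have "onorm (\<lambda>x. T x + c *\<^sub>R - A x) \<ge> onorm T" for c
        using ge[of "- c"] by simp
      then obtain y where y: "y \<in> norm_attainment_set T" "T y \<bullet> - A y \<ge> 0"
        by (rule onorm_add_mult_ge_imp_nonneg_inner[OF assms(2) bounded_linear_minus[OF A] pos])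
      then have "T y \<bullet> A y \<le> 0" by simp
      from norm_attaining_inner_zero[OF T A x y(1) this] show ?thesis by blast
    qed
  next
    assume "\<exists>x\<in>norm_attainment_set T. T x \<bullet> A x = 0"
    then obtain x where x: "norm x = 1" "norm (T x) = onorm T" "T x \<bullet> A x = 0"
      by (auto simp: norm_attainment_set_def)
    show "BJ_orthogonal T A"
      unfolding BJ_orthogonal_def
    proof
      fix c :: real
      have bl: "bounded_linear (\<lambda>x. T x + c *\<^sub>R A x)"
        using T A by (intro bounded_linear_add bounded_linear_scaleR_right[THEN bounded_linear_compose])
      \<comment> \<open>By Pythagoras, adding a multiple of \<open>A x\<close> cannot shorten
        \<open>T x\<close>; so \<open>x\<close> alone witnesses the lower bound for every
        \<open>c\<close>.\<close>
      have "(norm (T x + c *\<^sub>R A x))\<^sup>2 = (norm (T x))\<^sup>2 + (norm (c *\<^sub>R A x))\<^sup>2"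
        using x(3) by (intro norm_add_Pythagorean) (simp add: orthogonal_def)
      then have "(norm (T x))\<^sup>2 \<le> (norm (T x + c *\<^sub>R A x))\<^sup>2" by simp
      then have "norm (T x) \<le> norm (T x + c *\<^sub>R A x)" by (rule power2_le_imp_le) simp
      also have "\<dots> \<le> onorm (\<lambda>x. T x + c *\<^sub>R A x)" using onorm[OF bl, of x] x(1) by simp
      finally show "onorm T \<le> onorm (\<lambda>x. T x + c *\<^sub>R A x)" using x(2) by simp
    qed
  qed
qed

end
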